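(* Let $\theta\in\mathbb{R}\setminus\mathbb{Q}$ be a quadratic irrational. Let $\ell$ denote the (eventual) period of the simple continued fraction expansion of $\theta$, and let $M_\theta$ be the matrix (up to sign) corresponding to the simple continued fraction expansion of $\theta$. Then $$\beta(\theta)=\lim_{n\to\infty}\frac1n\log q_n=\frac{1}{\ell}\log \operatorname{rad}(M_\theta),$$ where $\operatorname{rad}(M_\theta)$ denotes the spectral radius (the largest modulus of an eigenvalue) of either of the matrices $\pm M_\theta$.
   Context: A quadratic irrational is a real algebraic number of degree exactly two. Write the simple continued fraction expansion of $\theta$ as $\theta=a_0+\cfrac{1}{a_1+\cfrac{1}{a_2+\cdots}}$ with $a_0=\lfloor\theta\rfloor$ and $a_n$ positive integers for $n\ge 1$; the denominators of the convergents are $q_0=1$, $q_1=a_1$, $q_n=a_nq_{n-1}+q_{n-2}$ for $n\ge 2$. Since $\theta$ is a quadratic irrational the sequence $(a_n)_{n\geq 1}$ is eventually periodic: there are $k\ge 0$ and $\ell\ge1$ with $a_{n+\ell}=a_n$ for all $n>k$. The period $\ell$ is the minimal such $\ell$, and $k$ is any pre-period (any $k\ge 0$ such that $a_{n+\ell}=a_n$ for all $n>k$). Set $$M_1=\begin{pmatrix}0&1\\1&a_{k+1}\end{pmatrix}\cdots\begin{pmatrix}0&1\\1&a_{k+\ell}\end{pmatrix},\qquad M_0=\begin{pmatrix}1&a_0\\0&1\end{pmatrix}\begin{pmatrix}0&1\\1&a_{1}\end{pmatrix}\cdots\begin{pmatrix}0&1\\1&a_{k}\end{pmatrix},\qquad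 M_\theta=M_0M_1M_0^{-1}.$$ $M_\theta$ is considered up to sign. The Lévy constant of $\theta$, when the limit exists, is $\beta(\theta)=\lim_{n\to\infty}\frac1n\log q_n$. *)

theory Defs
  imports
    "HOL-Analysis.Analysis"
    "Jordan_Normal_Form.Spectral_Radius"
    "Jordan_Normal_Form.Gauss_Jordan_Elimination"
begin

text \<open>Algebraic of degree exactly two: the minimal polynomial over the rationals, i.e. the
  irreducible rational polynomial vanishing at the number (unique up to a constant factor), has
  degree two.\<close>

definition quadratic_irrational :: "real \<Rightarrow> bool" where
  "quadratic_irrational \<theta> \<longleftrightarrow>
     (\<exists>p :: rat poly. irreducible p \<and> degree p = 2 \<and> poly (map_poly of_rat p) \<theta> = 0)"

text \<open>The simple continued fraction algorithm. It is only meaningful for irrational numbers, where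
  no complete quotient is an integer, so that the division by the fractional part is genuine at
  every step.\<close>

fun complete_quotient :: "real \<Rightarrow> nat \<Rightarrow> real" where
  "complete_quotient \<theta> 0 = \<theta>"
| "complete_quotient \<theta> (Suc n) = 1 / frac (complete_quotient \<theta> n)"

definition partial_quotient :: "real \<Rightarrow> nat \<Rightarrow> int" where
  "partial_quotient \<theta> n = \<lfloor>complete_quotient \<theta> n\<rfloor>"

fun cf_denom :: "real \<Rightarrow> nat \<Rightarrow> int" where
  "cf_denom \<theta> 0 = 1"
| "cf_denom \<theta> (Suc 0) = partial_quotient \<theta> 1"
| "cf_denom \<theta> (Suc (Suc n)) =
     partial_quotient \<theta> (Suc (Suc n)) * cf_denom \<theta> (Suc n) + cf_denom \<theta> n"

definition levy_constant :: "real \<Rightarrow> real" where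
  "levy_constant \<theta> = lim (\<lambda>n. ln (real_of_int (cf_denom \<theta> n)) / real n)"

definition cf_periodic_after :: "real \<Rightarrow> nat \<Rightarrow> nat \<Rightarrow> bool" where
  "cf_periodic_after \<theta> k l \<longleftrightarrow>
     l \<ge> 1 \<and> (\<forall>n>k. partial_quotient \<theta> (n + l) = partial_quotient \<theta> n)"

definition cf_period :: "real \<Rightarrow> nat" where
  "cf_period \<theta> = (LEAST l. \<exists>k. cf_periodic_after \<theta> k l)"

definition cf_preperiod :: "real \<Rightarrow> nat \<Rightarrow> bool" where
  "cf_preperiod \<theta> k \<longleftrightarrow> cf_periodic_after \<theta> k (cf_period \<theta>)"

text \<open>All matrices below have integer entries; they are taken over the complex numbers because
  that is where the spectral radius is defined.\<close>

definition cf_step_matrix :: "int \<Rightarrow> complex mat" where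
  "cf_step_matrix a = mat_of_rows_list 2 [[0, 1], [1, of_int a]]"

definition cf_block :: "real \<Rightarrow> nat \<Rightarrow> nat \<Rightarrow> complex mat" where
  "cf_block \<theta> i j =
     foldr (\<lambda>n A. cf_step_matrix (partial_quotient \<theta> n) * A) [i..<Suc j] (1\<^sub>m 2)"

definition cf_M1 :: "real \<Rightarrow> nat \<Rightarrow> complex mat" where
  "cf_M1 \<theta> k = cf_block \<theta> (k + 1) (k + cf_period \<theta>)"

definition cf_M0 :: "real \<Rightarrow> nat \<Rightarrow> complex mat" where
  "cf_M0 \<theta> k =
     mat_of_rows_list 2 [[1, of_int (partial_quotient \<theta> 0)], [0, 1]] * cf_block \<theta> 1 k"

text \<open>\<^const>\<open>cf_M0\<close> is a product of matrices of determinant \<open>1\<close> or \<open>-1\<close>, so its inverse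
  exists and \<^const>\<open>the\<close> is applied to a proper value.\<close>

definition cf_matrix :: "real \<Rightarrow> nat \<Rightarrow> complex mat" where
  "cf_matrix \<theta> k = cf_M0 \<theta> k * cf_M1 \<theta> k * the (mat_inverse (cf_M0 \<theta> k))"

end

theory Submission
  imports Defs
begin

text \<open>
  Write \<open>x\<^sub>n\<close> for the complete quotients, so that \<open>x\<^sub>n = a\<^sub>n + 1 / x\<^sub>n\<^sub>+\<^sub>1\<close>. Both sides of the
  formula are read off from products of the \<open>x\<^sub>n\<close>.

  On the one hand \<open>q\<^sub>n + q\<^sub>n\<^sub>+\<^sub>1 x\<^sub>n\<^sub>+\<^sub>2 = x\<^sub>1 \<cdots> x\<^sub>n\<^sub>+\<^sub>2\<close>, hence \<open>q\<^sub>n\<close> agrees with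
  \<open>x\<^sub>1 \<cdots> x\<^sub>n\<close> up to a factor of \<open>2\<close> (\<open>cf_denom_bounds\<close>), and \<open>ln q\<^sub>n / n\<close> has the same limit as
  the mean of \<open>ln x\<^sub>1, \<dots>, ln x\<^sub>n\<close>. Once the \<open>x\<^sub>n\<close> repeat with period \<open>l\<close>, this is the mean over
  one period, that is \<open>ln \<mu> / l\<close> with \<open>\<mu>\<close> the product of the \<open>x\<^sub>n\<close> over one period
  (\<open>ln_cf_denom_limit\<close>).

  On the other hand the step matrix of \<open>a\<^sub>n\<close> sends \<open>(1, x\<^sub>n\<^sub>+\<^sub>1)\<close> to \<open>x\<^sub>n\<^sub>+\<^sub>1 (1, x\<^sub>n)\<close>. Going once
  around the period, \<open>(1, x\<^sub>k\<^sub>+\<^sub>1)\<close> is an eigenvector of \<open>M\<^sub>1\<close> with eigenvalue \<open>\<mu> > 1\<close>. As the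
  determinant is \<open>1\<close> or \<open>-1\<close>, the other eigenvalue has modulus \<open>1 / \<mu>\<close>, so \<open>\<mu>\<close> is the spectral
  radius; conjugation and a change of sign leave it as it is (\<open>spectral_radius_cf_matrix\<close>).

  Two facts about periodicity are needed. That a period exists is Lagrange's theorem: every
  \<open>x\<^sub>n\<close> is a root of an integral quadratic form with the discriminant of the first one, and the
  coefficients of these forms stay bounded (\<open>integer_forms_bounded\<close>), so there are only finitely
  many \<open>x\<^sub>n\<close>. That a period of the \<open>a\<^sub>n\<close> is a period of the \<open>x\<^sub>n\<close> is the uniqueness of the
  expansion (\<open>partial_quotients_determine_complete_quotient\<close>). Both rest on the estimate that
  two consecutive fractional parts of complete quotients have product at most \<open>1 / 2\<close>.
\<close>

section \<open>Complete quotients\<close>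

lemma frac_irrational:
  fixes x :: real
  assumes "x \<notin> \<rat>"
  shows "frac x \<notin> \<rat>" "0 < frac x" "frac x < 1"
proof -
  show 1: "frac x \<notin> \<rat>"
  proof
    assume "frac x \<in> \<rat>"
    then have "frac x + of_int \<lfloor>x\<rfloor> \<in> \<rat>" by (intro Rats_add) auto
    then show False using assms by (simp add: frac_def)
  qed
  then have "frac x \<noteq> 0" by (metis Rats_0)
  then show "0 < frac x" using frac_ge_0[of x] by linarith
  show "frac x < 1" by (rule frac_lt_1)
qed

lemma complete_quotient_irrational:
  assumes "\<theta> \<notin> \<rat>"
  shows "complete_quotient \<theta> n \<notin> \<rat>"
proof (induction n)
  case (Suc n)
  show ?case
  proof
    assume "complete_quotient \<theta> (Suc n) \<in> \<rat>"
    then have "1 / complete_quotient \<theta> (Suc n) \<in> \<rat>" by (intro Rats_divide) auto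
    then show False using frac_irrational(1)[OF Suc.IH] by simp
  qed
qed (use assms in simp)

lemma frac_complete_quotient:
  "frac (complete_quotient \<theta> n) = complete_quotient \<theta> n - of_int (partial_quotient \<theta> n)"
  by (simp add: frac_def partial_quotient_def)

lemma complete_quotient_eq:
  "complete_quotient \<theta> n =
    of_int (partial_quotient \<theta> n) + 1 / complete_quotient \<theta> (Suc n)"
  using frac_complete_quotient[of \<theta> n] by simp

lemma complete_quotient_gt_1:
  assumes "\<theta> \<notin> \<rat>" and "1 \<le> n"
  shows "1 < complete_quotient \<theta> n"
proof -
  obtain m where n: "n = Suc m" using assms(2) by (cases n) auto
  show ?thesis
    using frac_irrational(2,3)[OF complete_quotient_irrational[OF assms(1), of m]] n by simp
qed

(* From here on x (Suc n) is handled through the bound x (Suc n) > 1, not as a nested fraction. *)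
declare complete_quotient.simps(2) [simp del]

lemma partial_quotient_ge_1:
  assumes "\<theta> \<notin> \<rat>" and "1 \<le> n"
  shows "1 \<le> partial_quotient \<theta> n"
  using complete_quotient_gt_1[OF assms] by (simp add: partial_quotient_def le_floor_iff)

text \<open>With \<open>u = x\<^sub>n\<^sub>+\<^sub>1 > 1\<close> the product is \<open>frac u / u\<close>, and a number above \<open>1\<close> is more than
  half integral part.\<close>

lemma consecutive_fracs:
  assumes "\<theta> \<notin> \<rat>"
  shows "frac (complete_quotient \<theta> n) * frac (complete_quotient \<theta> (Suc n)) \<le> 1 / 2"
proof -
  let ?t = "frac (complete_quotient \<theta> n)" and ?u = "complete_quotient \<theta> (Suc n)"
  have u: "1 < ?u" using complete_quotient_gt_1[OF assms] by simp
  have "real_of_int \<lfloor>?u\<rfloor> \<ge> 1" using u by (simp add: le_floor_iff)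
  moreover have "?u < real_of_int \<lfloor>?u\<rfloor> + 1" by linarith
  ultimately have "frac ?u \<le> ?u / 2" unfolding frac_def by linarith
  then have "?t * frac ?u \<le> ?t * (?u / 2)" by (intro mult_left_mono) auto
  also have "\<dots> = 1 / 2"
    using frac_irrational(2)[OF complete_quotient_irrational[OF assms, of n]]
    by (simp add: complete_quotient.simps(2))
  finally show ?thesis .
qed

lemma complete_quotient_shift:
  assumes "complete_quotient \<theta> m = complete_quotient \<theta> n"
  shows "complete_quotient \<theta> (m + d) = complete_quotient \<theta> (n + d)"
  using assms by (induction d) (auto simp: complete_quotient.simps(2))

text \<open>Equal integral parts make the difference of two complete quotients the difference of their
  fractional parts, hence the difference of the next complete quotients times the product of the
  two fractional parts. Two such steps gain a factor of \<open>1 / 4\<close>, and the differences never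
  exceed \<open>1\<close>, so iterating forces them to vanish.\<close>

lemma partial_quotients_determine_complete_quotient:
  assumes irr: "\<theta> \<notin> \<rat>"
    and eq: "\<And>d. partial_quotient \<theta> (m + d) = partial_quotient \<theta> (n + d)"
  shows "complete_quotient \<theta> m = complete_quotient \<theta> n"
proof -
  define x where "x d = complete_quotient \<theta> (m + d)" for d
  define y where "y d = complete_quotient \<theta> (n + d)" for d
  have pos: "0 < frac (x d)" "0 < frac (y d)" for d
    using frac_irrational(2)[OF complete_quotient_irrational[OF irr]] by (auto simp: x_def y_def)
  have step: "\<bar>x d - y d\<bar> = frac (x d) * frac (y d) * \<bar>x (Suc d) - y (Suc d)\<bar>" for d
  proof -
    have "x d - y d = frac (x d) - frac (y d)"
      using eq[of d] by (simp add: x_def y_def frac_complete_quotient)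
    also have "\<dots> = frac (x d) * frac (y d) * (y (Suc d) - x (Suc d))"
      using pos[of d] by (simp add: x_def y_def complete_quotient.simps(2) field_simps)
    finally show ?thesis using pos[of d] by (simp add: abs_mult abs_minus_commute)
  qed
  have step2: "\<bar>x d - y d\<bar> \<le> 1 / 4 * \<bar>x (Suc (Suc d)) - y (Suc (Suc d))\<bar>" for d
  proof -
    have "(frac (x d) * frac (x (Suc d))) * (frac (y d) * frac (y (Suc d))) \<le> 1 / 2 * (1 / 2)"
      using consecutive_fracs[OF irr, of "m + d"] consecutive_fracs[OF irr, of "n + d"] pos
      by (intro mult_mono) (auto simp: x_def y_def intro!: mult_nonneg_nonneg)
    then have "(frac (x d) * frac (x (Suc d))) * (frac (y d) * frac (y (Suc d)))
        * \<bar>x (Suc (Suc d)) - y (Suc (Suc d))\<bar> \<le> 1 / 4 * \<bar>x (Suc (Suc d)) - y (Suc (Suc d))\<bar>"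
      by (intro mult_right_mono) auto
    then show ?thesis by (subst step, subst step) (simp add: ac_simps)
  qed
  have "\<bar>x d - y d\<bar> \<le> (1 / 4) ^ N" for N d
  proof (induction N arbitrary: d)
    case 0
    have "\<bar>frac (x d) - frac (y d)\<bar> \<le> 1"
      using frac_ge_0[of "x d"] frac_lt_1[of "x d"] frac_ge_0[of "y d"] frac_lt_1[of "y d"]
      by linarith
    then show ?case using eq[of d] by (simp add: x_def y_def frac_complete_quotient)
  next
    case (Suc N)
    note step2[of d]
    also have "1 / 4 * \<bar>x (Suc (Suc d)) - y (Suc (Suc d))\<bar> \<le> 1 / 4 * (1 / 4) ^ N"
      by (intro mult_left_mono Suc.IH) auto
    finally show ?case by simp
  qed
  moreover have "(\<lambda>N. (1 / 4 :: real) ^ N) \<longlonglongrightarrow> 0" by (intro LIMSEQ_realpow_zero) auto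
  ultimately have "\<bar>x 0 - y 0\<bar> \<le> 0" by (intro LIMSEQ_le_const) auto
  then show ?thesis by (simp add: x_def y_def)
qed

lemma cf_periodic_after_complete_quotient:
  assumes irr: "\<theta> \<notin> \<rat>" and per: "cf_periodic_after \<theta> k l" and n: "k < n"
  shows "complete_quotient \<theta> (n + l) = complete_quotient \<theta> n"
proof (rule partial_quotients_determine_complete_quotient[OF irr])
  fix d
  have "partial_quotient \<theta> ((n + d) + l) = partial_quotient \<theta> (n + d)"
    using per n unfolding cf_periodic_after_def by auto
  then show "partial_quotient \<theta> (n + l + d) = partial_quotient \<theta> (n + d)"
    by (simp add: ac_simps)
qed

section \<open>Lagrange's theorem\<close>

text \<open>Clearing denominators: the argument for Lagrange's theorem counts integral coefficients.\<close>

lemma quadratic_irrational_integer_root: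
  assumes "quadratic_irrational \<theta>"
  obtains A B C :: int where "A \<noteq> 0"
    and "of_int A * \<theta>\<^sup>2 + of_int B * \<theta> + of_int C = 0"
proof -
  obtain p :: "rat poly" where deg: "degree p = 2"
    and root: "poly (map_poly of_rat p) \<theta> = 0"
    using assms unfolding quadratic_irrational_def by blast
  have "(\<Sum>i\<le>2. of_rat (coeff p i) * \<theta> ^ i) = 0"
    using root deg by (simp add: poly_altdef coeff_map_poly degree_map_poly)
  then have eq: "of_rat (coeff p 2) * \<theta>\<^sup>2 + of_rat (coeff p 1) * \<theta> + of_rat (coeff p 0) = 0"
    by (simp add: numeral_2_eq_2 atMost_Suc algebra_simps)
  have ex: "\<exists>a d :: int. d > 0 \<and> of_rat r = of_int a / (of_int d :: real)" for r
  proof -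
    obtain a d where "quotient_of r = (a, d)" by (cases "quotient_of r")
    then have "d > 0" "r = of_int a / of_int d"
      by (auto dest: quotient_of_denom_pos quotient_of_div)
    then show ?thesis by (metis of_rat_divide of_rat_of_int_eq)
  qed
  obtain a d where a: "d > 0" "of_rat (coeff p 2) = of_int a / (of_int d :: real)" using ex by blast
  obtain b e where b: "e > 0" "of_rat (coeff p 1) = of_int b / (of_int e :: real)" using ex by blast
  obtain c f where c: "f > 0" "of_rat (coeff p 0) = of_int c / (of_int f :: real)" using ex by blast
  have "coeff p 2 \<noteq> 0" using deg by (metis leading_coeff_0_iff degree_0 zero_neq_numeral)
  then have "a \<noteq> 0" using a by auto
  moreover have "of_int (a * e * f) * \<theta>\<^sup>2 + of_int (b * d * f) * \<theta> + of_int (c * d * e) = 0"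
    using eq a(1) b(1) c(1) unfolding a(2) b(2) c(2) by (simp add: field_simps)
  ultimately show thesis using that[of "a * e * f" "b * d * f" "c * d * e"] b(1) c(1) by simp
qed

text \<open>
  Put \<open>f = A X\<^sup>2 + B X + C\<close> and \<open>x = a + t\<close> with \<open>t = frac x\<close>. Substituting \<open>a + 1 / Y\<close> for \<open>X\<close>
  turns a form with root \<open>x\<close> into one with root \<open>1 / t\<close>, leading coefficient \<open>A' = f(a)\<close> and
  constant coefficient \<open>A\<close>. The derivative \<open>2 A x + B\<close>, a square root of the discriminant, only
  changes sign. Taylor expansion at \<open>x\<close> gives \<open>A' = A t\<^sup>2 - (2 A x + B) t\<close>, whence
  \<open>\<bar>A'\<bar> \<le> (\<bar>A\<bar> t + \<bar>s\<bar>) t\<close>. The bound on \<open>\<bar>A\<bar> t\<close> rather than on \<open>\<bar>A\<bar>\<close> is what makes the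
  induction close: if \<open>\<bar>A\<bar> t \<le> K\<close>, then \<open>\<bar>A'\<bar> \<le> 2 K t\<close>, and multiplying by the next
  fractional part \<open>t'\<close> brings this back below \<open>K\<close> because \<open>t t' \<le> 1 / 2\<close>.
\<close>

lemma integer_forms_bounded:
  assumes irr: "\<theta> \<notin> \<rat>"
    and A0: "A0 \<noteq> 0" and root: "of_int A0 * \<theta>\<^sup>2 + of_int B0 * \<theta> + of_int C0 = 0"
    and s: "s = 2 * of_int A0 * \<theta> + of_int B0"
    and K: "K = \<bar>of_int A0\<bar> + \<bar>of_int C0\<bar> + \<bar>s\<bar>"
  shows "\<exists>A B C :: int. let x = complete_quotient \<theta> n in
    A \<noteq> 0 \<and> of_int A * x\<^sup>2 + of_int B * x + of_int C = 0 \<and>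
    2 * of_int A * x + of_int B \<in> {s, - s} \<and>
    \<bar>of_int A\<bar> * frac x \<le> K \<and> \<bar>of_int A\<bar> \<le> 2 * K \<and> \<bar>of_int C\<bar> \<le> 2 * K"
proof (induction n)
  case 0
  have "\<bar>of_int A0\<bar> * frac \<theta> \<le> \<bar>of_int A0\<bar> * 1"
    using frac_lt_1[of \<theta>] by (intro mult_left_mono) auto
  moreover have "\<bar>of_int A0\<bar> \<le> K" "\<bar>of_int C0\<bar> \<le> K" "0 \<le> K" unfolding K by linarith+
  ultimately have "\<bar>of_int A0\<bar> * frac \<theta> \<le> K \<and> \<bar>of_int A0\<bar> \<le> 2 * K \<and> \<bar>of_int C0\<bar> \<le> 2 * K"
    by linarith
  then show ?case unfolding Let_def complete_quotient.simps(1) using A0 root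
    by (intro exI[of _ A0] exI[of _ B0] exI[of _ C0]) (simp add: s)
next
  case (Suc n)
  define x where "x = complete_quotient \<theta> n"
  define t where "t = frac x"
  define a where "a = partial_quotient \<theta> n"
  define y where "y = complete_quotient \<theta> (Suc n)"
  obtain A B C :: int where *: "A \<noteq> 0" "of_int A * x\<^sup>2 + of_int B * x + of_int C = 0"
    "2 * of_int A * x + of_int B \<in> {s, - s}"
    "\<bar>of_int A\<bar> * t \<le> K" "\<bar>of_int A\<bar> \<le> 2 * K" "\<bar>of_int C\<bar> \<le> 2 * K"
    using Suc.IH unfolding x_def t_def Let_def by blast
  define \<sigma> where "\<sigma> = 2 * of_int A * x + of_int B"
  have t: "0 < t" "t < 1"
    using frac_irrational[OF complete_quotient_irrational[OF irr]] by (auto simp: t_def x_def)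
  have y: "y = 1 / t" by (simp add: y_def t_def x_def complete_quotient.simps(2))
  have ta: "x = of_int a + t" using frac_complete_quotient[of \<theta> n] by (simp add: t_def x_def a_def)
  define A' where "A' = A * a\<^sup>2 + B * a + C"
  define B' where "B' = 2 * A * a + B"
  have A't: "of_int A' = of_int A * t\<^sup>2 - \<sigma> * t"
    using *(2) unfolding A'_def \<sigma>_def ta by (simp add: algebra_simps power2_eq_square)
  have B't: "of_int B' = \<sigma> - 2 * of_int A * t"
    unfolding B'_def \<sigma>_def ta by (simp add: algebra_simps)
  have root': "of_int A' * y\<^sup>2 + of_int B' * y + of_int A = 0"
    unfolding A't B't y using t by (simp add: field_simps power2_eq_square)
  have der: "2 * of_int A' * y + of_int B' = - \<sigma>"
    unfolding A't B't y using t by (simp add: field_simps power2_eq_square)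
  have \<sigma>s: "\<bar>\<sigma>\<bar> = \<bar>s\<bar>" "\<sigma> \<in> {s, -s}" using *(3) by (auto simp: \<sigma>_def)
  have sK: "\<bar>s\<bar> \<le> K" unfolding K by linarith
  have "\<bar>of_int A'\<bar> \<le> \<bar>of_int A * t\<^sup>2\<bar> + \<bar>\<sigma> * t\<bar>" unfolding A't by (rule abs_triangle_ineq4)
  also have "\<dots> = (\<bar>of_int A\<bar> * t + \<bar>s\<bar>) * t"
    using t \<sigma>s by (simp add: abs_mult power2_eq_square algebra_simps)
  also have "\<dots> \<le> (2 * K) * t" using t sK *(4) by (intro mult_right_mono) auto
  finally have A'b: "\<bar>of_int A'\<bar> \<le> 2 * K * t" .
  have K0: "0 \<le> K" unfolding K by linarith
  have b1: "\<bar>of_int A'\<bar> \<le> 2 * K"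
    using A'b mult_left_mono[of t 1 "2 * K"] t K0 by simp
  have fy: "0 \<le> frac y" by simp
  have "\<bar>of_int A'\<bar> * frac y \<le> 2 * K * t * frac y" by (intro mult_right_mono A'b fy)
  also have "\<dots> = 2 * K * (t * frac y)" by simp
  also have "\<dots> \<le> 2 * K * (1 / 2)"
    using consecutive_fracs[OF irr, of n] K0
    by (intro mult_left_mono) (auto simp: t_def x_def y_def)
  finally have b2: "\<bar>of_int A'\<bar> * frac y \<le> K" by simp
  \<comment> \<open>A vanishing leading coefficient would make \<open>t\<close> rational.\<close>
  have A'0: "A' \<noteq> 0"
  proof
    assume "A' = 0"
    then have "of_int A * t = \<sigma>" using A't t by (simp add: power2_eq_square)
    then have "of_int A * t = - of_int B'" using B't by simp
    then have "t = - of_int B' / of_int A" using *(1) by (simp add: field_simps)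
    then have "t \<in> \<rat>" by simp
    then show False
      using frac_irrational(1)[OF complete_quotient_irrational[OF irr]] by (auto simp: t_def x_def)
  qed
  have "- \<sigma> \<in> {s, -s}" using \<sigma>s by auto
  then show ?case
    unfolding Let_def y_def[symmetric]
    using A'0 root' der b1 b2 *(5) by (intro exI[of _ A'] exI[of _ B'] exI[of _ A]) auto
qed

text \<open>A root is determined by \<open>A\<close>, \<open>B\<close> and the sign of \<open>2 A x + B\<close>; bounds on \<open>A\<close> and \<open>C\<close> bound
  \<open>B\<close> through the discriminant.\<close>

lemma finite_complete_quotients:
  assumes irr: "\<theta> \<notin> \<rat>" and quad: "quadratic_irrational \<theta>"
  shows "finite (range (complete_quotient \<theta>))"
proof -
  obtain A0 B0 C0 :: int where 0: "A0 \<noteq> 0"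
      "of_int A0 * \<theta>\<^sup>2 + of_int B0 * \<theta> + of_int C0 = 0"
    using quadratic_irrational_integer_root[OF quad] by blast
  define s where "s = 2 * of_int A0 * \<theta> + of_int B0"
  define K where "K = \<bar>of_int A0\<bar> + \<bar>of_int C0\<bar> + \<bar>s\<bar>"
  \<comment> \<open>The discriminant gives \<open>B\<^sup>2 \<le> K\<^sup>2 + 16 K\<^sup>2\<close>, rounded up to \<open>(5 K)\<^sup>2\<close>.\<close>
  define N where "N = \<lceil>5 * K\<rceil>"
  have "range (complete_quotient \<theta>) \<subseteq>
    (\<lambda>(\<sigma>, A, B). (\<sigma> - of_int B) / (2 * of_int A)) ` ({s, - s} \<times> {-N..N} \<times> {-N..N})"
  proof
    fix x assume "x \<in> range (complete_quotient \<theta>)"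
    then obtain n where x: "x = complete_quotient \<theta> n" by blast
    obtain A B C :: int where *: "A \<noteq> 0" "of_int A * x\<^sup>2 + of_int B * x + of_int C = 0"
      "2 * of_int A * x + of_int B \<in> {s, - s}"
      "\<bar>of_int A\<bar> \<le> 2 * K" "\<bar>of_int C\<bar> \<le> 2 * K"
      using integer_forms_bounded[OF irr 0 s_def K_def, of n] unfolding x Let_def by blast
    define \<sigma> where "\<sigma> = 2 * of_int A * x + of_int B"
    have K0: "0 \<le> K" "\<bar>s\<bar> \<le> K" unfolding K_def by linarith+
    have "(of_int B)\<^sup>2 = \<sigma>\<^sup>2 + 4 * (of_int A * of_int C) - 4 * of_int A * (of_int A * x\<^sup>2 + of_int B * x + of_int C)"
      unfolding \<sigma>_def by (simp add: power2_eq_square algebra_simps)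
    also have "\<dots> = s\<^sup>2 + 4 * (of_int A * of_int C)" using *(2,3) by (auto simp: \<sigma>_def)
    also have "\<dots> \<le> K\<^sup>2 + 4 * (2 * K * (2 * K))"
    proof -
      have "s\<^sup>2 \<le> K\<^sup>2" using K0 by (simp add: abs_le_square_iff[symmetric])
      moreover have "\<bar>of_int A * of_int C\<bar> \<le> 2 * K * (2 * K)"
        unfolding abs_mult using *(4,5) K0 by (intro mult_mono) auto
      ultimately show ?thesis by linarith
    qed
    also have "\<dots> \<le> (5 * K)\<^sup>2" by (simp add: power2_eq_square)
    finally have "\<bar>of_int B\<bar> \<le> \<bar>5 * K\<bar>" by (simp only: abs_le_square_iff)
    then have "\<bar>of_int B\<bar> \<le> 5 * K" using K0 by simp
    then have "B \<in> {-N..N}" unfolding N_def by (auto simp: abs_le_iff) linarith+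
    moreover have "\<bar>of_int A\<bar> \<le> 5 * K" using *(4) K0 by linarith
    then have "A \<in> {-N..N}" unfolding N_def by (auto simp: abs_le_iff) linarith+
    moreover have "x = (\<sigma> - of_int B) / (2 * of_int A)" using *(1) by (simp add: \<sigma>_def)
    moreover have "\<sigma> \<in> {s, -s}" using *(3) by (simp add: \<sigma>_def)
    ultimately show "x \<in> (\<lambda>(\<sigma>, A, B). (\<sigma> - of_int B) / (2 * of_int A)) ` ({s, - s} \<times> {-N..N} \<times> {-N..N})"
      by (intro image_eqI[of _ _ "(\<sigma>, A, B)"]) auto
  qed
  then show ?thesis by (rule finite_subset) auto
qed

lemma Lagrange_eventually_periodic:
  assumes irr: "\<theta> \<notin> \<rat>" and quad: "quadratic_irrational \<theta>"
  shows "\<exists>k. cf_preperiod \<theta> k"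
proof -
  have "\<not> inj (complete_quotient \<theta>)"
    using finite_complete_quotients[OF irr quad] finite_imageD infinite_UNIV_nat by blast
  then obtain i j where ij: "i < j" "complete_quotient \<theta> i = complete_quotient \<theta> j"
    unfolding inj_on_def by (metis linorder_neqE_nat)
  have "cf_periodic_after \<theta> i (j - i)"
    unfolding cf_periodic_after_def
  proof (intro conjI allI impI)
    fix n assume "n > i"
    then have "complete_quotient \<theta> (n + (j - i)) = complete_quotient \<theta> n"
      using complete_quotient_shift[OF ij(2), of "n - i"] ij(1) by (simp add: add.commute)
    then show "partial_quotient \<theta> (n + (j - i)) = partial_quotient \<theta> n"
      by (simp add: partial_quotient_def)
  qed (use ij in auto)
  then have "\<exists>l k. cf_periodic_after \<theta> k l" by blast
  then show ?thesis unfolding cf_preperiod_def cf_period_def by (rule LeastI_ex)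
qed

section \<open>Growth of the denominators\<close>

lemma cf_denom_mono:
  assumes "\<theta> \<notin> \<rat>"
  shows "1 \<le> cf_denom \<theta> n \<and> cf_denom \<theta> n \<le> cf_denom \<theta> (Suc n)"
proof (induction n)
  case 0
  show ?case using partial_quotient_ge_1[OF assms, of 1] by simp
next
  case (Suc n)
  have "1 * cf_denom \<theta> (Suc n) \<le> partial_quotient \<theta> (Suc (Suc n)) * cf_denom \<theta> (Suc n)"
    using Suc partial_quotient_ge_1[OF assms, of "Suc (Suc n)"] by (intro mult_right_mono) linarith+
  moreover have "0 \<le> cf_denom \<theta> n" using Suc by linarith
  ultimately have "cf_denom \<theta> (Suc n) \<le> cf_denom \<theta> (Suc (Suc n))" by simp
  then show ?case using Suc by linarith
qed

text \<open>The linear form \<open>q\<^sub>n + q\<^sub>n\<^sub>+\<^sub>1 x\<^sub>n\<^sub>+\<^sub>2\<close> is multiplied by \<open>x\<^sub>n\<^sub>+\<^sub>3\<close> in each step, since the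
  recurrence of the denominators matches \<open>x\<^sub>n\<^sub>+\<^sub>2 = a\<^sub>n\<^sub>+\<^sub>2 + 1 / x\<^sub>n\<^sub>+\<^sub>3\<close>.\<close>

lemma cf_denom_complete_quotient_prod:
  assumes "\<theta> \<notin> \<rat>"
  shows "of_int (cf_denom \<theta> n) + of_int (cf_denom \<theta> (Suc n)) * complete_quotient \<theta> (Suc (Suc n))
    = (\<Prod>j=1..Suc (Suc n). complete_quotient \<theta> j)"
proof (induction n)
  case 0
  have "complete_quotient \<theta> 2 > 1" using complete_quotient_gt_1[OF assms] by simp
  then show ?case using complete_quotient_eq[of \<theta> 1]
    by (simp add: numeral_2_eq_2 field_simps)
next
  case (Suc n)
  define x where "x = complete_quotient \<theta> (Suc (Suc (Suc n)))"
  have "x > 1" using complete_quotient_gt_1[OF assms] by (simp add: x_def)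
  have "(\<Prod>j=1..Suc (Suc (Suc n)). complete_quotient \<theta> j) =
      (of_int (cf_denom \<theta> n) + of_int (cf_denom \<theta> (Suc n)) * complete_quotient \<theta> (Suc (Suc n))) * x"
    using Suc by (simp add: x_def)
  also have "complete_quotient \<theta> (Suc (Suc n)) = of_int (partial_quotient \<theta> (Suc (Suc n))) + 1 / x"
    unfolding x_def by (rule complete_quotient_eq)
  finally have P: "(\<Prod>j=1..Suc (Suc (Suc n)). complete_quotient \<theta> j) =
      (of_int (cf_denom \<theta> n) + of_int (cf_denom \<theta> (Suc n)) *
        (of_int (partial_quotient \<theta> (Suc (Suc n))) + 1 / x)) * x" .
  show ?case unfolding P x_def[symmetric] using \<open>x > 1\<close> by (simp add: field_simps)
qed

text \<open>In \<open>q\<^sub>n\<^sub>-\<^sub>1 + q\<^sub>n x\<^sub>n\<^sub>+\<^sub>1 = x\<^sub>1 \<cdots> x\<^sub>n\<^sub>+\<^sub>1\<close> the first summand lies between \<open>0\<close> and the second;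
  dividing by \<open>x\<^sub>n\<^sub>+\<^sub>1\<close> gives both bounds.\<close>

lemma cf_denom_bounds:
  assumes "\<theta> \<notin> \<rat>"
  shows "of_int (cf_denom \<theta> n) \<le> (\<Prod>j=1..n. complete_quotient \<theta> j)"
    and "(\<Prod>j=1..n. complete_quotient \<theta> j) \<le> 2 * of_int (cf_denom \<theta> n)"
proof -
  have "of_int (cf_denom \<theta> n) \<le> (\<Prod>j=1..n. complete_quotient \<theta> j) \<and>
      (\<Prod>j=1..n. complete_quotient \<theta> j) \<le> 2 * of_int (cf_denom \<theta> n)"
  proof (cases n)
    case (Suc m)
    define x where "x = complete_quotient \<theta> (Suc (Suc m))"
    define P where "P = (\<Prod>j=1..Suc m. complete_quotient \<theta> j)"
    define q where "q = real_of_int (cf_denom \<theta> (Suc m))"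
    have x: "x > 1" using complete_quotient_gt_1[OF assms] by (simp add: x_def)
    have eq: "of_int (cf_denom \<theta> m) + q * x = P * x"
      using cf_denom_complete_quotient_prod[OF assms, of m]
      by (simp add: x_def P_def q_def del: cf_denom.simps)
    have q: "0 \<le> real_of_int (cf_denom \<theta> m)" "real_of_int (cf_denom \<theta> m) \<le> q" "0 \<le> q"
      using cf_denom_mono[OF assms, of m] unfolding q_def by linarith+
    have "q * x \<le> P * x" using eq q by linarith
    then have 1: "q \<le> P" using x by simp
    have "q * 1 \<le> q * x" using q x by (intro mult_left_mono) auto
    then have "P * x \<le> (2 * q) * x" using eq q by linarith
    then have "P \<le> 2 * q" using x by simp
    with 1 show ?thesis by (simp add: Suc P_def q_def del: cf_denom.simps)
  qed simp
  then show "of_int (cf_denom \<theta> n) \<le> (\<Prod>j=1..n. complete_quotient \<theta> j)"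
    "(\<Prod>j=1..n. complete_quotient \<theta> j) \<le> 2 * of_int (cf_denom \<theta> n)" by auto
qed

lemma ln_cf_denom_approx:
  assumes "\<theta> \<notin> \<rat>"
  shows "\<bar>ln (real_of_int (cf_denom \<theta> n)) - (\<Sum>j=1..n. ln (complete_quotient \<theta> j))\<bar> \<le> ln 2"
proof -
  let ?q = "real_of_int (cf_denom \<theta> n)" and ?P = "\<Prod>j=1..n. complete_quotient \<theta> j"
  have q: "?q > 0" using cf_denom_mono[OF assms, of n] by simp
  have "ln ?P = (\<Sum>j=1..n. ln (complete_quotient \<theta> j))"
    using complete_quotient_gt_1[OF assms] by (intro ln_prod) force+
  moreover have "ln ?q \<le> ln ?P" using q cf_denom_bounds(1)[OF assms, of n] by simp
  moreover have "ln ?P \<le> ln (2 * ?q)"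
    using q cf_denom_bounds[OF assms, of n] by (intro ln_mono) linarith+
  moreover have "ln (2 * ?q) = ln 2 + ln ?q" using q by (simp add: ln_mult)
  ultimately show ?thesis by auto
qed

lemma eventually_periodic_bounded:
  fixes g :: "nat \<Rightarrow> real"
  assumes l: "l \<ge> 1" and per: "\<And>n. n \<ge> k \<Longrightarrow> g (n + l) = g n"
  shows "\<exists>C. \<forall>n. \<bar>g n\<bar> \<le> C"
proof -
  have "g n \<in> g ` {..<k + l}" for n
  proof (induction n rule: less_induct)
    case (less n)
    show ?case
    proof (cases "n < k + l")
      case False
      then have "g n = g (n - l)" using per[of "n - l"] by simp
      then show ?thesis using less[of "n - l"] False l by simp
    qed auto
  qed
  then have "\<bar>g n\<bar> \<le> Max (abs ` g ` {..<k + l})" for n by (intro Max_ge) auto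
  then show ?thesis by blast
qed

text \<open>Subtracting the mean over one period from each term makes the partial sums themselves
  eventually periodic, hence bounded.\<close>

lemma Cesaro_mean_eventually_periodic:
  fixes f :: "nat \<Rightarrow> real"
  assumes l: "l \<ge> 1" and per: "\<And>n. n > k \<Longrightarrow> f (n + l) = f n"
  shows "\<exists>C. \<forall>n. \<bar>(\<Sum>j=1..n. f j) - real n * ((\<Sum>j=k+1..k+l. f j) / real l)\<bar> \<le> C"
proof -
  define c where "c = (\<Sum>j=k+1..k+l. f j)"
  have window: "(\<Sum>j=n+1..n+l. f j) = c" if "n \<ge> k" for n
    using that
  proof (induction n rule: dec_induct)
    case (step n)
    have "(\<Sum>j=n+1..Suc n+l. f j) = f (n + 1) + (\<Sum>j=Suc n+1..Suc n+l. f j)"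
      by (subst sum.atLeast_Suc_atMost) auto
    moreover have "(\<Sum>j=n+1..Suc n+l. f j) = (\<Sum>j=n+1..n+l. f j) + f (Suc n + l)"
      by simp
    ultimately show ?case using step per[of "Suc n"] by simp
  qed (simp add: c_def)
  have "(\<Sum>j=1..n+l. f j) - real (n + l) * (c / real l) = (\<Sum>j=1..n. f j) - real n * (c / real l)"
    if "n \<ge> k" for n
  proof -
    have "(\<Sum>j=1..n+l. f j) = (\<Sum>j=1..n. f j) + (\<Sum>j=n+1..n+l. f j)"
      by (intro sum.ub_add_nat) auto
    then show ?thesis using window[OF that] l by (simp add: field_simps)
  qed
  then show ?thesis unfolding c_def[symmetric] by (intro eventually_periodic_bounded[OF l])
qed

lemma ln_cf_denom_limit:
  assumes irr: "\<theta> \<notin> \<rat>" and per: "cf_periodic_after \<theta> k l"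
  shows "(\<lambda>n. ln (real_of_int (cf_denom \<theta> n)) / real n) \<longlonglongrightarrow>
    1 / real l * ln (\<Prod>j=k+1..k+l. complete_quotient \<theta> j)"
proof -
  define c where "c = (\<Sum>j=k+1..k+l. ln (complete_quotient \<theta> j)) / real l"
  have l: "l \<ge> 1" using per by (simp add: cf_periodic_after_def)
  obtain C where C: "\<bar>(\<Sum>j=1..n. ln (complete_quotient \<theta> j)) - real n * c\<bar> \<le> C" for n
    using Cesaro_mean_eventually_periodic[OF l, of k "\<lambda>j. ln (complete_quotient \<theta> j)"]
      cf_periodic_after_complete_quotient[OF irr per] unfolding c_def by auto
  have b: "\<bar>ln (real_of_int (cf_denom \<theta> n)) - real n * c\<bar> \<le> C + ln 2" for n
    using C[of n] ln_cf_denom_approx[OF irr, of n] by linarith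
  have "(\<lambda>n. ln (real_of_int (cf_denom \<theta> n)) / real n - c) \<longlonglongrightarrow> 0"
  proof (rule tendsto_rabs_zero_cancel, rule tendsto_sandwich[where f = "\<lambda>_. 0" and h = "\<lambda>n. (C + ln 2) / real n"])
    show "\<forall>\<^sub>F n in sequentially. \<bar>ln (real_of_int (cf_denom \<theta> n)) / real n - c\<bar> \<le> (C + ln 2) / real n"
    proof (rule eventually_sequentiallyI)
      fix n :: nat assume n: "n \<ge> 1"
      then have "\<bar>ln (real_of_int (cf_denom \<theta> n)) / real n - c\<bar>
          = \<bar>ln (real_of_int (cf_denom \<theta> n)) - real n * c\<bar> / real n"
        by (subst abs_of_pos[of "real n", symmetric], simp, subst abs_divide[symmetric]) (simp add: diff_divide_distrib)
      then show "\<bar>ln (real_of_int (cf_denom \<theta> n)) / real n - c\<bar> \<le> (C + ln 2) / real n"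
        using b[of n] by (simp add: divide_right_mono)
    qed
    show "(\<lambda>n. (C + ln 2) / real n) \<longlonglongrightarrow> 0"
      by (rule lim_const_over_n)
  qed auto
  then have "(\<lambda>n. ln (real_of_int (cf_denom \<theta> n)) / real n) \<longlonglongrightarrow> c" by (simp add: LIM_zero_iff)
  moreover have "complete_quotient \<theta> j \<noteq> 0" if "j \<in> {k+1..k+l}" for j
    using complete_quotient_gt_1[OF irr, of j] that by auto
  then have "ln (\<Prod>j=k+1..k+l. complete_quotient \<theta> j) =
      (\<Sum>j=k+1..k+l. ln (complete_quotient \<theta> j))"
    by (intro ln_prod) auto
  ultimately show ?thesis by (simp add: c_def)
qed

section \<open>The spectral radius of the period matrix\<close>

lemma det_2x2:
  fixes A :: "'a :: comm_ring_1 mat"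
  assumes "A \<in> carrier_mat 2 2"
  shows "Determinant.det A = A $$ (0,0) * A $$ (1,1) - A $$ (0,1) * A $$ (1,0)"
proof -
  have minor: "Determinant.det (mat_delete A 0 j) = A $$ (1, 1 - j)" if "j < 2" for j
    using that assms
    by (subst det_single) (auto simp: mat_delete_def less_2_cases_iff)
  have "Determinant.det A = (\<Sum>j<2. A $$ (0,j) * cofactor A 0 j)"
    by (rule laplace_expansion_row[OF assms]) simp
  then show ?thesis by (simp add: cofactor_def minor numeral_2_eq_2 lessThan_Suc)
qed

text \<open>The two eigenvalues multiply to the determinant, so one of them has modulus at least \<open>1\<close> and
  the other at most \<open>1\<close>.\<close>

lemma spectral_radius_2x2_unimodular:
  fixes A :: "complex mat"
  assumes A: "A \<in> carrier_mat 2 2" and det: "cmod (Determinant.det A) = 1"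
    and ev: "eigenvalue A \<mu>" and ge: "1 \<le> cmod \<mu>"
  shows "spectral_radius A = cmod \<mu>"
proof -
  define T where "T = A $$ (0,0) + A $$ (1,1)"
  have char: "z\<^sup>2 - T * z + Determinant.det A = 0" if "eigenvalue A z" for z
  proof -
    have c: "char_matrix A z \<in> carrier_mat 2 2" using A by simp
    have "Determinant.det (char_matrix A z) = 0" using that by (simp add: eigenvalue_det[OF A])
    moreover have char_entries: "char_matrix A z $$ (i,j) = A $$ (i,j) - (if i = j then z else 0)"
      if "i < 2" "j < 2" for i j
      using that A by (simp add: char_matrix_def)
    ultimately show ?thesis
      by (simp add: det_2x2[OF c] det_2x2[OF A] T_def char_entries power2_eq_square algebra_simps)
  qed
  have other: "cmod z \<le> cmod \<mu>" if "eigenvalue A z" for z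
  proof (cases "z = \<mu>")
    case False
    have "(z - \<mu>) * (z + \<mu> - T) = (z\<^sup>2 - T * z + Determinant.det A) - (\<mu>\<^sup>2 - T * \<mu> + Determinant.det A)"
      by (simp add: power2_eq_square algebra_simps)
    then have "z + \<mu> = T" using char[OF that] char[OF ev] False by simp
    then have "z * \<mu> = Determinant.det A" using char[OF ev]
      by (auto simp: power2_eq_square algebra_simps eq_neg_iff_add_eq_0)
    then have "cmod z * cmod \<mu> = 1" using det by (metis norm_mult)
    then have "cmod z \<le> 1" using ge
      by (metis mult.right_neutral mult_left_mono norm_ge_zero)
    then show ?thesis using ge by linarith
  qed simp
  show ?thesis
  proof (rule antisym)
    show "spectral_radius A \<le> cmod \<mu>"
      using spectral_radius_mem_max(1)[OF A zero_less_numeral] other by (auto simp: spectrum_def)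
    show "cmod \<mu> \<le> spectral_radius A"
      using spectral_radius_mem_max(2)[OF A zero_less_numeral] ev by (auto simp: spectrum_def)
  qed
qed

definition cq_vec :: "real \<Rightarrow> nat \<Rightarrow> complex vec" where
  "cq_vec \<theta> n = vec_of_list [1, of_real (complete_quotient \<theta> n)]"

lemma cf_step_matrix_carrier [simp]: "cf_step_matrix a \<in> carrier_mat 2 2"
  by (auto simp: cf_step_matrix_def mat_of_rows_list_def numeral_2_eq_2)

lemma cq_vec_carrier [simp]: "cq_vec \<theta> n \<in> carrier_vec 2"
  by (intro carrier_vecI) (simp add: cq_vec_def)

lemma det_cf_step_matrix: "Determinant.det (cf_step_matrix a) = -1"
  by (subst det_2x2) (auto simp: cf_step_matrix_def mat_of_rows_list_def numeral_2_eq_2)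

lemma cf_step_matrix_mult_cq_vec:
  assumes "\<theta> \<notin> \<rat>"
  shows "cf_step_matrix (partial_quotient \<theta> n) *\<^sub>v cq_vec \<theta> (Suc n) =
    of_real (complete_quotient \<theta> (Suc n)) \<cdot>\<^sub>v cq_vec \<theta> n"
proof -
  define x where "x = complete_quotient \<theta> (Suc n)"
  have "x > 1" using complete_quotient_gt_1[OF assms] by (simp add: x_def)
  have "x * complete_quotient \<theta> n = 1 + of_int (partial_quotient \<theta> n) * x"
    using complete_quotient_eq[of \<theta> n] \<open>x > 1\<close> unfolding x_def[symmetric]
    by (simp add: field_simps)
  then have "complex_of_real x * complex_of_real (complete_quotient \<theta> n)
      = 1 + of_int (partial_quotient \<theta> n) * complex_of_real x"
    by (metis of_real_1 of_real_add of_real_mult of_real_of_int_eq)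
  then show ?thesis
    unfolding cq_vec_def x_def[symmetric]
    by (intro eq_vecI) (auto simp: cf_step_matrix_def mat_of_rows_list_def scalar_prod_def less_2_cases_iff numeral_2_eq_2 less_Suc_eq)
qed

lemma cf_block_empty: "cf_block \<theta> (Suc j) j = 1\<^sub>m 2"
  by (simp add: cf_block_def)

lemma cf_block_Cons:
  assumes "i \<le> j"
  shows "cf_block \<theta> i j = cf_step_matrix (partial_quotient \<theta> i) * cf_block \<theta> (Suc i) j"
  using assms by (simp add: cf_block_def upt_conv_Cons del: upt_Suc)

text \<open>The chain rule \<open>cf_step_matrix_mult_cq_vec\<close> telescopes along the block. The product runs over
  \<open>x\<^sub>i\<^sub>+\<^sub>1, \<dots>, x\<^sub>j\<^sub>+\<^sub>1\<close>: the step at \<open>n\<close> contributes the factor \<open>x\<^sub>n\<^sub>+\<^sub>1\<close>.\<close>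

lemma cf_block_props:
  assumes irr: "\<theta> \<notin> \<rat>" and "i \<le> Suc j"
  shows "cf_block \<theta> i j \<in> carrier_mat 2 2 \<and> cmod (Determinant.det (cf_block \<theta> i j)) = 1 \<and>
    cf_block \<theta> i j *\<^sub>v cq_vec \<theta> (Suc j) =
      of_real (\<Prod>n=i..j. complete_quotient \<theta> (Suc n)) \<cdot>\<^sub>v cq_vec \<theta> i"
  using assms(2)
proof (induction i rule: inc_induct)
  case base
  show ?case by (simp add: cf_block_empty)
next
  case (step i)
  let ?S = "cf_step_matrix (partial_quotient \<theta> i)" and ?B = "cf_block \<theta> (Suc i) j"
  have ij: "i \<le> j" using step.hyps by simp
  have B: "?B \<in> carrier_mat 2 2" using step by simp
  have "?S * ?B *\<^sub>v cq_vec \<theta> (Suc j) = ?S *\<^sub>v (?B *\<^sub>v cq_vec \<theta> (Suc j))"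
    by (rule assoc_mult_mat_vec[OF cf_step_matrix_carrier B]) simp
  also have "\<dots> = of_real (\<Prod>n=Suc i..j. complete_quotient \<theta> (Suc n)) \<cdot>\<^sub>v (?S *\<^sub>v cq_vec \<theta> (Suc i))"
    using step.IH by (simp add: mult_mat_vec[of _ 2 2])
  also have "\<dots> = of_real (\<Prod>n=i..j. complete_quotient \<theta> (Suc n)) \<cdot>\<^sub>v cq_vec \<theta> i"
    using ij by (simp add: cf_step_matrix_mult_cq_vec[OF irr] smult_smult_assoc
      prod.atLeast_Suc_atMost[of i j] mult.commute)
  finally have "?S * ?B *\<^sub>v cq_vec \<theta> (Suc j) = \<dots>" .
  moreover have "cmod (Determinant.det (?S * ?B)) = 1"
    using step.IH by (simp add: det_mult[of _ 2] norm_mult det_cf_step_matrix)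
  moreover have "?S * ?B \<in> carrier_mat 2 2" using B by (intro mult_carrier_mat[of _ 2 2]) auto
  ultimately show ?case by (simp only: cf_block_Cons[OF ij])
qed

lemma cf_M1_eigenvector:
  assumes irr: "\<theta> \<notin> \<rat>" and pre: "cf_preperiod \<theta> k"
  shows "cf_M1 \<theta> k \<in> carrier_mat 2 2" "cmod (Determinant.det (cf_M1 \<theta> k)) = 1"
    and "cf_M1 \<theta> k *\<^sub>v cq_vec \<theta> (k + 1) =
      of_real (\<Prod>j=k+1..k+cf_period \<theta>. complete_quotient \<theta> j) \<cdot>\<^sub>v cq_vec \<theta> (k + 1)"
proof -
  define l where "l = cf_period \<theta>"
  have per: "cf_periodic_after \<theta> k l" using pre by (simp add: cf_preperiod_def l_def)
  then have l: "l \<ge> 1" by (simp add: cf_periodic_after_def)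
  have cyc: "complete_quotient \<theta> (k + 1 + l) = complete_quotient \<theta> (k + 1)"
    using cf_periodic_after_complete_quotient[OF irr per, of "k + 1"] by simp
  \<comment> \<open>The window shifted by one has the same product, as its ends agree by periodicity.\<close>
  have "(\<Prod>n=k+1..k+l. complete_quotient \<theta> (Suc n)) = (\<Prod>n=Suc (k+1)..Suc (k+l). complete_quotient \<theta> n)"
    by (rule prod.shift_bounds_cl_Suc_ivl[symmetric])
  also have "\<dots> = (\<Prod>n=k+1..k+l. complete_quotient \<theta> n)"
    using l cyc prod.atLeast_Suc_atMost[of "k+1" "k+l" "complete_quotient \<theta>"]
    by (simp add: mult.commute add.commute)
  finally have prod: "(\<Prod>n=k+1..k+l. complete_quotient \<theta> (Suc n)) = (\<Prod>n=k+1..k+l. complete_quotient \<theta> n)" .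
  have vec: "cq_vec \<theta> (Suc (k + l)) = cq_vec \<theta> (k + 1)" using cyc by (simp add: cq_vec_def)
  have "k + 1 \<le> Suc (k + l)" by simp
  from cf_block_props[OF irr this, unfolded vec prod]
  show "cf_M1 \<theta> k \<in> carrier_mat 2 2" "cmod (Determinant.det (cf_M1 \<theta> k)) = 1"
    "cf_M1 \<theta> k *\<^sub>v cq_vec \<theta> (k + 1) =
      of_real (\<Prod>j=k+1..k+cf_period \<theta>. complete_quotient \<theta> j) \<cdot>\<^sub>v cq_vec \<theta> (k + 1)"
    by (auto simp: cf_M1_def l_def)
qed

lemma cf_M0_props:
  assumes irr: "\<theta> \<notin> \<rat>"
  shows "cf_M0 \<theta> k \<in> carrier_mat 2 2" "cmod (Determinant.det (cf_M0 \<theta> k)) = 1"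
proof -
  let ?U = "mat_of_rows_list 2 [[1, of_int (partial_quotient \<theta> 0)], [0, 1]] :: complex mat"
  have U: "?U \<in> carrier_mat 2 2" by (auto simp: mat_of_rows_list_def numeral_2_eq_2)
  have dU: "Determinant.det ?U = 1" by (subst det_2x2) (auto simp: mat_of_rows_list_def numeral_2_eq_2)
  have B: "cf_block \<theta> 1 k \<in> carrier_mat 2 2" "cmod (Determinant.det (cf_block \<theta> 1 k)) = 1"
    using cf_block_props[OF irr, of 1 k] by auto
  show "cf_M0 \<theta> k \<in> carrier_mat 2 2" unfolding cf_M0_def by (rule mult_carrier_mat[OF U B(1)])
  show "cmod (Determinant.det (cf_M0 \<theta> k)) = 1" unfolding cf_M0_def det_mult[OF U B(1)] using dU B(2) by simp
qed

text \<open>Conjugation by \<open>P\<close> carries the eigenvector \<open>v\<close> to \<open>P v\<close> and keeps the determinant; negation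
  turns \<open>\<mu>\<close> into \<open>-\<mu>\<close> and, in even dimension, keeps the determinant as well. So the preceding
  criterion applies to both matrices.\<close>

lemma spectral_radius_conjugate_2x2_unimodular:
  fixes P M :: "complex mat"
  assumes P: "P \<in> carrier_mat 2 2" and dP: "cmod (Determinant.det P) = 1"
    and M: "M \<in> carrier_mat 2 2" and dM: "cmod (Determinant.det M) = 1"
    and ev: "eigenvector M v \<mu>" and ge: "1 \<le> cmod \<mu>"
    and N: "N \<in> {P * M * the (mat_inverse P), - (P * M * the (mat_inverse P))}"
  shows "spectral_radius N = cmod \<mu>"
proof -
  have "Determinant.det P \<noteq> 0" using dP by auto
  then have "mat_inverse P \<noteq> None"
    using mat_inverse(1)[OF P, where b = "()"] det_non_zero_imp_unit[OF P, where b = "()"] by blast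
  then obtain Q where Qe: "mat_inverse P = Some Q" by blast
  then have Q: "Q \<in> carrier_mat 2 2" "P * Q = 1\<^sub>m 2" "Q * P = 1\<^sub>m 2"
    using mat_inverse(2)[OF P Qe] by auto
  define R where "R = P * M * Q"
  have R: "R \<in> carrier_mat 2 2" unfolding R_def using P M Q(1) by auto
  have "Determinant.det P * Determinant.det Q = 1" using det_mult[OF P Q(1)] Q(2) by simp
  moreover have "Determinant.det R = Determinant.det P * Determinant.det M * Determinant.det Q"
    unfolding R_def using P M Q(1) by (simp add: det_mult[of _ 2])
  ultimately have "Determinant.det R = Determinant.det M" by (simp add: algebra_simps)
  then have dR: "cmod (Determinant.det R) = 1" using dM by simp
  have v: "v \<in> carrier_vec 2" "v \<noteq> 0\<^sub>v 2" "M *\<^sub>v v = \<mu> \<cdot>\<^sub>v v"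
    using ev M by (auto simp: eigenvector_def)
  have Pv: "P *\<^sub>v v \<in> carrier_vec 2" using P v by auto
  have QPv: "Q *\<^sub>v (P *\<^sub>v v) = v"
    using assoc_mult_mat_vec[OF Q(1) P v(1)] Q(3) v(1) by simp
  have "R *\<^sub>v (P *\<^sub>v v) = P *\<^sub>v (M *\<^sub>v (Q *\<^sub>v (P *\<^sub>v v)))"
    unfolding R_def using P M Q(1) v(1)
    by (simp add: assoc_mult_mat_vec[of _ 2 2 _ 2])
  also have "\<dots> = \<mu> \<cdot>\<^sub>v (P *\<^sub>v v)" unfolding QPv v(3) by (rule mult_mat_vec[OF P v(1)])
  finally have RP: "R *\<^sub>v (P *\<^sub>v v) = \<mu> \<cdot>\<^sub>v (P *\<^sub>v v)" .
  have nz: "P *\<^sub>v v \<noteq> 0\<^sub>v 2"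
  proof
    assume "P *\<^sub>v v = 0\<^sub>v 2"
    then have "v = Q *\<^sub>v 0\<^sub>v 2" using QPv by simp
    moreover have "Q *\<^sub>v 0\<^sub>v 2 = 0\<^sub>v 2" using Q(1) by (intro eq_vecI) auto
    ultimately show False using v(2) by simp
  qed
  have "eigenvector R (P *\<^sub>v v) \<mu>" using R Pv nz RP by (auto simp: eigenvector_def)
  then have "spectral_radius R = cmod \<mu>"
    by (intro spectral_radius_2x2_unimodular[OF R dR _ ge]) (auto simp: eigenvalue_def)
  moreover have "spectral_radius (- R) = cmod (- \<mu>)"
  proof (rule spectral_radius_2x2_unimodular)
    show "- R \<in> carrier_mat 2 2" using R by auto
    show "cmod (Determinant.det (- R)) = 1" using dR R by (simp add: det_2x2[of "- R"] det_2x2[OF R])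
    have "dim_vec (P *\<^sub>v v) = dim_col R" using R Pv by (metis carrier_matD(2) carrier_vecD)
    then have "- R *\<^sub>v (P *\<^sub>v v) = - (R *\<^sub>v (P *\<^sub>v v))" by (rule uminus_mult_mat_vec)
    also have "\<dots> = - \<mu> \<cdot>\<^sub>v (P *\<^sub>v v)" unfolding RP by (intro eq_vecI) auto
    finally have "- R *\<^sub>v (P *\<^sub>v v) = - \<mu> \<cdot>\<^sub>v (P *\<^sub>v v)" .
    then have "eigenvector (- R) (P *\<^sub>v v) (- \<mu>)" using R Pv nz by (auto simp: eigenvector_def)
    then show "eigenvalue (- R) (- \<mu>)" by (auto simp: eigenvalue_def)
  qed (use ge in simp)
  ultimately show ?thesis using N by (auto simp: R_def Qe)
qed

lemma spectral_radius_cf_matrix: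
  assumes irr: "\<theta> \<notin> \<rat>" and pre: "cf_preperiod \<theta> k"
    and M: "M \<in> {cf_matrix \<theta> k, - cf_matrix \<theta> k}"
  shows "spectral_radius M = (\<Prod>j=k+1..k+cf_period \<theta>. complete_quotient \<theta> j)"
proof -
  define \<mu> where "\<mu> = (\<Prod>j=k+1..k+cf_period \<theta>. complete_quotient \<theta> j)"
  have "1 \<le> \<mu>" unfolding \<mu>_def
    using complete_quotient_gt_1[OF irr] by (intro prod_ge_1) (auto intro: less_imp_le)
  have "cq_vec \<theta> (k + 1) $ 0 \<noteq> 0" by (simp add: cq_vec_def)
  then have "cq_vec \<theta> (k + 1) \<noteq> 0\<^sub>v 2" by auto
  then have "eigenvector (cf_M1 \<theta> k) (cq_vec \<theta> (k + 1)) (of_real \<mu>)"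
    using cf_M1_eigenvector[OF irr pre] by (auto simp: eigenvector_def \<mu>_def)
  then have "spectral_radius M = cmod (of_real \<mu>)"
    using M \<open>1 \<le> \<mu>\<close> cf_M1_eigenvector[OF irr pre] cf_M0_props[OF irr]
    unfolding cf_matrix_def
    by (intro spectral_radius_conjugate_2x2_unimodular[of "cf_M0 \<theta> k" "cf_M1 \<theta> k"]) auto
  then show ?thesis using \<open>1 \<le> \<mu>\<close> unfolding \<mu>_def[symmetric] by simp
qed

section \<open>The Levy constant\<close>

theorem theorem1p3:
  fixes \<theta> :: real
  assumes "\<theta> \<notin> \<rat>" and "quadratic_irrational \<theta>"
  shows "(\<exists>k. cf_preperiod \<theta> k) \<and>
    (\<lambda>n. ln (real_of_int (cf_denom \<theta> n)) / real n) \<longlonglongrightarrow> levy_constant \<theta> \<and>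
    (\<forall>k. cf_preperiod \<theta> k \<longrightarrow> (\<forall>M \<in> {cf_matrix \<theta> k, - cf_matrix \<theta> k}.
       levy_constant \<theta> = 1 / real (cf_period \<theta>) * ln (spectral_radius M)))"
proof -
  obtain k where k: "cf_preperiod \<theta> k" using Lagrange_eventually_periodic[OF assms] by blast
  have lim: "(\<lambda>n. ln (real_of_int (cf_denom \<theta> n)) / real n) \<longlonglongrightarrow>
      1 / real (cf_period \<theta>) * ln (\<Prod>j=k+1..k+cf_period \<theta>. complete_quotient \<theta> j)"
    if "cf_preperiod \<theta> k" for k
    using that ln_cf_denom_limit[OF assms(1)] by (simp add: cf_preperiod_def)
  have levy: "levy_constant \<theta> =
      1 / real (cf_period \<theta>) * ln (\<Prod>j=k+1..k+cf_period \<theta>. complete_quotient \<theta> j)"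
    if "cf_preperiod \<theta> k" for k
    using limI[OF lim[OF that]] by (simp add: levy_constant_def)
  show ?thesis
  proof (intro conjI allI impI ballI)
    show "(\<lambda>n. ln (real_of_int (cf_denom \<theta> n)) / real n) \<longlonglongrightarrow> levy_constant \<theta>"
      using lim[OF k] levy[OF k] by simp
    fix k M assume "cf_preperiod \<theta> k" "M \<in> {cf_matrix \<theta> k, - cf_matrix \<theta> k}"
    then show "levy_constant \<theta> = 1 / real (cf_period \<theta>) * ln (spectral_radius M)"
      using levy spectral_radius_cf_matrix[OF assms(1)] by simp
  qed (use k in blast)
qed

end
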